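(* Let $E$ be a finite commutative semifield of order $q$. Then the set of $q+1$ mutually unbiased bases of $\mathbb{C}^q$ formed by the standard basis together with the (normalized) characters of the group $H$ restricted to $H_0$ is monomial.
   Context: A finite semifield is a finite set $E$ with operations $+$ and $\circ$ such that: $(E,+)$ is an abelian group with identity $0$; $x\circ y=0$ implies $x=0$ or $y=0$; both distributive laws hold; and there is a multiplicative identity $1\ne0$. (Multiplication need not be associative.) It is commutative if $\circ$ is commutative. $H=\{H_{u,b}:u,b\in E\}$ is the abelian group of order $q^2$ with multiplication $H_{u,b}H_{v,d}=H_{u+v,\,b+d+u\circ v}$, and $H_0=\{H_{u,0}:u\in E\}$. Let $N=\{H_{0,b}:b\in E\}$. The characters of $H$ trivial on $N$ form a subgroup $H^*_0$ of order $q$ of the character group of $H$; for each of the $q$ cosets of $H_0^*$, the vectors $\frac1{\sqrt q}\chi|_{H_0}\in\mathbb{C}^{H_0}\cong\mathbb{C}^q$, with $\chi$ in the coset, form an orthonormal basis. These $q$ bases and the standard basis are the $q+1$ mutually unbiased bases in the statement (two orthonormal bases $\{x_i\}$, $\{y_j\}$ are mutually unbiased if $|\langle x_i,y_j\rangle|$ is the same for all $i,j$). Two sets of mutually unbiased bases $\{B_0,\dots,B_m\}$ and $\{B_0',\dots,B_m'\}$ of $\mathbb{C}^n$ are equivalent if there is a unitary $U$ with $\{U(B_0),\dots,U(B_m)\}=\{B'_0,\dots,B'_m\}$, where vectors are identified when they span the same one-dimensional subspace. A maximal commuting basis is a collection of $n\times n$ unitary matrices $C=C_1\cup\cdots\cup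 C_m$ such that $|C_i|=n$, $I\in C_i$, the matrices in each $C_i$ commute with each other, and distinct matrices of $C$ are pairwise orthogonal for the trace inner product, with $C_i\cap C_j=\{I\}$ for $i\neq j$. A set of mutually unbiased bases $\{B_1,\dots,B_m\}$ is obtained by partitioning $C$ if $B_i$ consists of common eigenvectors of $C_i$ for each $i$. A set of mutually unbiased bases is monomial if it is equivalent to a set of mutually unbiased bases obtained by partitioning some maximal commuting basis $C$ all of whose matrices are monomial (exactly one nonzero entry in each row and column). *)

theory Defs
  imports "HOL-Analysis.Analysis" "HOL-Algebra.Coset"
begin

section \<open>Finite commutative semifields\<close>

text \<open>The additive group of the semifield is that of the type; multiplication is not assumed to
  be associative, so none of the library's ring classes applies.\<close>

locale finite_semifield =
  fixes mul :: "'a::{finite,ab_group_add} \<Rightarrow> 'a \<Rightarrow> 'a" and unit :: 'a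
  assumes mul_eq_0: "mul x y = 0 \<Longrightarrow> x = 0 \<or> y = 0"
    and distrib_left: "mul x (y + z) = mul x y + mul x z"
    and distrib_right: "mul (x + y) z = mul x z + mul y z"
    and unit_left: "mul unit x = x"
    and unit_right: "mul x unit = x"
    and unit_neq_0: "unit \<noteq> 0"

locale finite_commutative_semifield = finite_semifield +
  assumes mul_commute: "mul x y = mul y x"

section \<open>Mutually unbiased bases\<close>

text \<open>The library's inner product on \<^typ>\<open>complex ^ 'n\<close> is the real one; this is the Hermitian one.\<close>

definition cinner :: "complex ^ 'n \<Rightarrow> complex ^ 'n \<Rightarrow> complex" where
  "cinner x y = (\<Sum>i\<in>UNIV. cnj (x $ i) * y $ i)"

definition orthonormal_basis :: "(complex ^ 'n) set \<Rightarrow> bool" where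
  "orthonormal_basis B \<longleftrightarrow>
     (\<forall>x\<in>B. \<forall>y\<in>B. cinner x y = (if x = y then 1 else 0)) \<and> vec.span B = UNIV"

definition mutually_unbiased :: "(complex ^ 'n) set \<Rightarrow> (complex ^ 'n) set \<Rightarrow> bool" where
  "mutually_unbiased B B' \<longleftrightarrow> (\<exists>c. \<forall>x\<in>B. \<forall>y\<in>B'. cmod (cinner x y) = c)"

definition mub_set :: "(complex ^ 'n) set set \<Rightarrow> bool" where
  "mub_set \<B> \<longleftrightarrow> finite \<B> \<and> (\<forall>B\<in>\<B>. orthonormal_basis B) \<and>
     (\<forall>B\<in>\<B>. \<forall>B'\<in>\<B>. B \<noteq> B' \<longrightarrow> mutually_unbiased B B')"

definition standard_basis :: "(complex ^ 'n) set" where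
  "standard_basis = range (\<lambda>i. axis i 1)"

definition adjoint_matrix :: "complex ^ 'n ^ 'm \<Rightarrow> complex ^ 'm ^ 'n" where
  "adjoint_matrix A = (\<chi> i j. cnj (A $ j $ i))"

definition unitary_matrix :: "complex ^ 'n ^ 'n \<Rightarrow> bool" where
  "unitary_matrix U \<longleftrightarrow> adjoint_matrix U ** U = mat 1 \<and> U ** adjoint_matrix U = mat 1"

text \<open>Vectors matter only up to the complex line they span.\<close>

definition lines :: "(complex ^ 'n) set \<Rightarrow> (complex ^ 'n) set set" where
  "lines B = (\<lambda>x. vec.span {x}) ` B"

definition mub_equivalent :: "(complex ^ 'n) set set \<Rightarrow> (complex ^ 'n) set set \<Rightarrow> bool" where
  "mub_equivalent \<B> \<B>' \<longleftrightarrow>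
     (\<exists>U. unitary_matrix U \<and> (\<lambda>B. lines ((*v) U ` B)) ` \<B> = lines ` \<B>')"

section \<open>Maximal commuting bases\<close>

definition trace_inner :: "complex ^ 'n ^ 'n \<Rightarrow> complex ^ 'n ^ 'n \<Rightarrow> complex" where
  "trace_inner A B = trace (adjoint_matrix A ** B)"

text \<open>The classes are \<open>C 1, \<dots>, C m\<close>; values of \<open>C\<close> at other indices are irrelevant.\<close>

definition maximal_commuting_basis :: "nat \<Rightarrow> (nat \<Rightarrow> (complex ^ 'n ^ 'n) set) \<Rightarrow> bool" where
  "maximal_commuting_basis m C \<longleftrightarrow>
     (\<forall>i\<in>{1..m}. card (C i) = CARD('n) \<and> mat 1 \<in> C i \<and>
        (\<forall>A\<in>C i. unitary_matrix A) \<and> (\<forall>A\<in>C i. \<forall>B\<in>C i. A ** B = B ** A)) \<and>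
     (\<forall>A\<in>(\<Union>i\<in>{1..m}. C i). \<forall>B\<in>(\<Union>i\<in>{1..m}. C i). A \<noteq> B \<longrightarrow> trace_inner A B = 0) \<and>
     (\<forall>i\<in>{1..m}. \<forall>j\<in>{1..m}. i \<noteq> j \<longrightarrow> C i \<inter> C j = {mat 1})"

definition obtained_by_partitioning ::
    "(complex ^ 'n) set set \<Rightarrow> nat \<Rightarrow> (nat \<Rightarrow> (complex ^ 'n ^ 'n) set) \<Rightarrow> bool" where
  "obtained_by_partitioning \<B> m C \<longleftrightarrow>
     (\<exists>B. bij_betw B {1..m} \<B> \<and>
        (\<forall>i\<in>{1..m}. \<forall>x\<in>B i. \<forall>A\<in>C i. x \<noteq> 0 \<and> (\<exists>c. A *v x = c *s x)))"

definition monomial_matrix :: "complex ^ 'n ^ 'n \<Rightarrow> bool" where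
  "monomial_matrix A \<longleftrightarrow> (\<forall>i. \<exists>!j. A $ i $ j \<noteq> 0) \<and> (\<forall>j. \<exists>!i. A $ i $ j \<noteq> 0)"

definition monomial_mubs :: "(complex ^ 'n) set set \<Rightarrow> bool" where
  "monomial_mubs \<B> \<longleftrightarrow> mub_set \<B> \<and>
     (\<exists>\<B>' m C. mub_set \<B>' \<and> mub_equivalent \<B> \<B>' \<and>
        maximal_commuting_basis m C \<and> (\<forall>i\<in>{1..m}. \<forall>A\<in>C i. monomial_matrix A) \<and>
        obtained_by_partitioning \<B>' m C)"

section \<open>Characters\<close>

definition complex_units :: "complex monoid" where
  "complex_units = \<lparr>carrier = UNIV - {0}, mult = (*), one = 1\<rparr>"

text \<open>Intended for groups \<open>G\<close> whose carrier is the whole type: there, functions equal on the carrier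
  are equal.\<close>

definition character_group :: "('g, 'm) monoid_scheme \<Rightarrow> ('g \<Rightarrow> complex) monoid" where
  "character_group G =
     \<lparr>carrier = hom G complex_units, mult = (\<lambda>f g x. f x * g x), one = (\<lambda>_. 1)\<rparr>"

section \<open>The bases of a semifield\<close>

text \<open>The pair \<open>(u, b)\<close> stands for \<open>H\<^bsub>u,b\<^esub>\<close>.\<close>

definition H_group :: "('a::ab_group_add \<Rightarrow> 'a \<Rightarrow> 'a) \<Rightarrow> ('a \<times> 'a) monoid" where
  "H_group mul =
     \<lparr>carrier = UNIV, mult = (\<lambda>(u, b) (v, d). (u + v, b + d + mul u v)), one = (0, 0)\<rparr>"

definition N_subgroup :: "('a::ab_group_add \<times> 'a) set" where
  "N_subgroup = range (\<lambda>b. (0, b))"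

definition H0_star :: "('a::ab_group_add \<Rightarrow> 'a \<Rightarrow> 'a) \<Rightarrow> ('a \<times> 'a \<Rightarrow> complex) set" where
  "H0_star mul = {f \<in> carrier (character_group (H_group mul)). \<forall>x\<in>N_subgroup. f x = 1}"

text \<open>The coordinate \<open>u\<close> of \<^typ>\<open>complex ^ 'a\<close> corresponds to the element \<open>H\<^bsub>u,0\<^esub>\<close> of \<open>H\<^sub>0\<close>.\<close>

definition restricted_character :: "('a \<times> 'a \<Rightarrow> complex) \<Rightarrow> complex ^ ('a::{finite,ab_group_add})" where
  "restricted_character f = (\<chi> u. f (u, 0) / complex_of_real (sqrt (real CARD('a))))"

definition semifield_bases ::
    "('a \<Rightarrow> 'a \<Rightarrow> 'a) \<Rightarrow> (complex ^ ('a::{finite,ab_group_add})) set set" where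
  "semifield_bases mul =
     insert standard_basis
       ((\<lambda>K. restricted_character ` K) ` (rcosets\<^bsub>character_group (H_group mul)\<^esub> H0_star mul))"

end

theory Submission
  imports Defs "HOL-Combinatorics.Cycles" "HOL-Algebra.Multiplicative_Group"
begin

text \<open>
  Write \<open>\<phi>\<close> for a character of \<open>(E, +)\<close> and \<open>v\<close> for an element of \<open>E\<close>. The Weyl matrices
  \<open>(weyl \<phi> v) x = (u \<mapsto> \<phi>(u) x(u + v))\<close> are monomial, unitary and pairwise orthogonal. A character \<open>f\<close> of
  \<open>H\<close> that restricts to \<open>\<phi>\<close> on \<open>N\<close> satisfies \<open>f(u + v) \<phi>(u \<circ> v) = f(u) f(v)\<close> on \<open>H\<^sub>0\<close>, which says exactly
  that \<open>f\<close> is an eigenvector, with eigenvalue \<open>f(v)\<close>, of the Weyl matrix belonging to the character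
  \<open>u \<mapsto> \<phi>(u \<circ> v)\<close> and the shift \<open>v\<close>. Letting \<open>v\<close> vary gives the commuting class of the basis attached to
  \<open>\<phi>\<close>; the diagonal Weyl matrices form the class of the standard basis. Hence the bases are
  obtained by partitioning a monomial maximal commuting basis, without applying any unitary.
\<close>

section \<open>Characters of finite abelian groups\<close>

text \<open>For \<open>i > 0\<close> this is a geometric sum whose ratio is an \<open>n\<close>-th
  root of unity other than 1: exchanging the roles of \<open>i\<close> and \<open>j\<close> turns it
  into powers of one root \<open>?w\<close>.\<close>

lemma sum_powers_root_of_unity:
  assumes "n > 0" "i < n"
  shows "(\<Sum>j<n. (cis (2 * pi * real j / real n)) ^ i) = (if i = 0 then of_nat n else 0)"
proof (cases "i = 0")
  case False
  let ?w = "cis (2 * pi * real i / real n)"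
  have "(\<Sum>j<n. (cis (2 * pi * real j / real n)) ^ i) = (\<Sum>j<n. ?w ^ j)"
    unfolding Complex.DeMoivre by (intro sum.cong arg_cong[of _ _ cis]) auto
  \<comment> \<open>The \<open>n\<close> roots of unity belonging to indices below \<open>n\<close>
    are distinct, and 1 already belongs to index 0.\<close>
  moreover have "?w \<noteq> 1"
  proof
    assume "?w = 1"
    then have "cis (2 * pi * real i / real n) = cis (2 * pi * real 0 / real n)" by simp
    then have "i = 0"
      using Complex.bij_betw_roots_unity[OF assms(1)] assms
      by (intro inj_onD[of "\<lambda>k. cis (2 * pi * real k / real n)" "{..<n}"]) (auto simp: bij_betw_def)
    then show False using False by simp
  qed
  moreover have "?w ^ n = 1"
    unfolding Complex.DeMoivre using assms by simp
  ultimately show ?thesis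
    using False by (simp add: geometric_sum)
qed simp

text \<open>Averaging \<open>F \<circ> s ^^ i\<close> against the powers of an \<open>n\<close>-th root of unity projects onto an eigenspace of
  \<open>s\<close>, and the \<open>n\<close> projections of \<open>F\<close> sum to \<open>n F\<close>, so one of them is nonzero. Closure of the subspace
  \<open>W\<close> is what later prescribes the values of characters.\<close>

lemma common_eigenfunction:
  fixes W :: "('x \<Rightarrow> complex) set" and S :: "('x \<Rightarrow> 'x) set"
  assumes "finite S"
    and order: "\<And>s. s \<in> S \<Longrightarrow> \<exists>n>0. s ^^ n = id"
    and comm: "\<And>s t. s \<in> S \<Longrightarrow> t \<in> S \<Longrightarrow> s \<circ> t = t \<circ> s"
    and W_add: "\<And>F G. F \<in> W \<Longrightarrow> G \<in> W \<Longrightarrow> (\<lambda>x. F x + G x) \<in> W"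
    and W_scale: "\<And>F c. F \<in> W \<Longrightarrow> (\<lambda>x. c * F x) \<in> W"
    and W_closed: "\<And>F s. F \<in> W \<Longrightarrow> s \<in> S \<Longrightarrow> F \<circ> s \<in> W"
    and W_nonzero: "F0 \<in> W" "F0 \<noteq> (\<lambda>_. 0)"
  shows "\<exists>F\<in>W. F \<noteq> (\<lambda>_. 0) \<and> (\<forall>s\<in>S. \<exists>c. \<forall>x. F (s x) = c * F x)"
  using \<open>finite S\<close> order comm W_closed
proof (induction S)
  case empty
  then show ?case using W_nonzero by auto
next
  case (insert s S)
  obtain F where F: "F \<in> W" "F \<noteq> (\<lambda>_. 0)" and eig: "\<forall>t\<in>S. \<exists>c. \<forall>x. F (t x) = c * F x"
    using insert by (metis insert_iff)
  obtain n where n: "n > 0" "s ^^ n = id" using insert.prems(1) by blast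
  have iter: "(\<lambda>x. F ((s ^^ i) x)) \<in> W" for i
  proof (induction i)
    case (Suc i)
    from insert.prems(3)[OF this, of s] show ?case by (simp add: o_def funpow_swap1)
  qed (use F in simp)
  have W_sum: "(\<lambda>x. \<Sum>i<k. c i * F ((s ^^ i) x)) \<in> W" for c and k :: nat
  proof (induction k)
    case 0
    show ?case using W_scale[OF F(1), of 0] by simp
  next
    case (Suc k)
    from W_add[OF this W_scale[OF iter, of "c k" k]] show ?case by simp
  qed
  define z where "z = (\<lambda>j. cis (2 * pi * real j / real n))"
  define P where "P = (\<lambda>j x. \<Sum>i<n. (z j) ^ i * F ((s ^^ i) x))"
  have z: "z j ^ n = 1" for j
    unfolding z_def Complex.DeMoivre using n by simp
  have "(\<Sum>j<n. P j x) = of_nat n * F x" for x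
  proof -
    have "(\<Sum>j<n. P j x) = (\<Sum>i<n. (\<Sum>j<n. z j ^ i) * F ((s ^^ i) x))"
      unfolding P_def sum_distrib_right by (rule sum.swap)
    also have "\<dots> = (\<Sum>i<n. if i = 0 then of_nat n * F x else 0)"
      using sum_powers_root_of_unity[OF n(1)] by (intro sum.cong) (auto simp: z_def)
    finally show ?thesis using n by simp
  qed
  moreover obtain x0 where "F x0 \<noteq> 0" using F by auto
  ultimately have "(\<Sum>j<n. P j x0) \<noteq> 0" using n by simp
  then obtain j where j: "P j x0 \<noteq> 0"
    by (metis sum.neutral)
  \<comment> \<open>The factor \<open>z j\<close> and the map \<open>s\<close> both raise the
    summation index by one; the two boundary terms cancel because \<open>z j ^ n = 1\<close> and
    \<open>s ^^ n = id\<close>.\<close>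
  have "z j * P j (s x) = P j x" for x
  proof -
    have "z j * P j (s x) = (\<Sum>i<n. z j ^ Suc i * F ((s ^^ Suc i) x))"
      unfolding P_def sum_distrib_left by (simp add: funpow_swap1 mult_ac)
    also have "\<dots> = P j x + z j ^ n * F ((s ^^ n) x) - F x"
      unfolding P_def
      using sum.lessThan_Suc_shift[of "\<lambda>i. z j ^ i * F ((s ^^ i) x)" n] by (simp del: funpow.simps)
    finally show ?thesis by (simp add: n z)
  qed
  then have "P j (s x) = inverse (z j) * P j x" for x
    by (metis z_def cis_neq_zero mult.assoc left_inverse mult_1)
  \<comment> \<open>Since \<open>t\<close> commutes with \<open>s\<close>, the projection keeps the
    eigenvalues that \<open>F\<close> already had.\<close>
  moreover have "\<exists>c. \<forall>x. P j (t x) = c * P j x" if "t \<in> S" for t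
  proof -
    obtain c where c: "\<And>x. F (t x) = c * F x" using eig \<open>t \<in> S\<close> by auto
    have st: "s (t x) = t (s x)" for x
      using insert.prems(2)[of s t] \<open>t \<in> S\<close> by (auto simp: fun_eq_iff)
    have "(s ^^ i) (t x) = t ((s ^^ i) x)" for i x
      by (induction i) (auto simp: st)
    then have "P j (t x) = c * P j x" for x
      by (simp add: P_def c sum_distrib_left mult_ac)
    then show ?thesis by blast
  qed
  moreover have "P j \<in> W" unfolding P_def by (rule W_sum)
  moreover have "P j \<noteq> (\<lambda>_. 0)" using j by auto
  ultimately show ?case by blast
qed

lemma bij_finite_order:
  fixes s :: "'x::finite \<Rightarrow> 'x"
  assumes "bij s"
  shows "\<exists>n>0. s ^^ n = id"
  using permutation_is_nilpotent[of s] assms by (metis finite permutation)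

text \<open>Translations of an abelian group commute, so \<open>W\<close> contains a common
  eigenfunction \<open>F\<close>. Its eigenvalue at \<open>g\<close>, as a function of
  \<open>g\<close>, is multiplicative and proportional to \<open>F\<close>, hence a character inside
  \<open>W\<close>. Suitable choices of \<open>W\<close> later force prescribed properties of the
  character.\<close>

lemma exists_character_in:
  fixes G :: "('g::finite, 'm) monoid_scheme" and W :: "('g \<Rightarrow> complex) set"
  assumes "comm_group G" and carrier: "carrier G = UNIV"
    and W_add: "\<And>F F'. F \<in> W \<Longrightarrow> F' \<in> W \<Longrightarrow> (\<lambda>x. F x + F' x) \<in> W"
    and W_scale: "\<And>F c. F \<in> W \<Longrightarrow> (\<lambda>x. c * F x) \<in> W"
    and W_closed: "\<And>F g. F \<in> W \<Longrightarrow> (\<lambda>x. F (g \<otimes>\<^bsub>G\<^esub> x)) \<in> W"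
    and W_nonzero: "F0 \<in> W" "F0 \<noteq> (\<lambda>_. 0)"
  shows "\<exists>\<theta>\<in>W. \<theta> \<in> hom G complex_units"
proof -
  interpret comm_group G by fact
  let ?S = "range (\<lambda>g x. g \<otimes>\<^bsub>G\<^esub> x)"
  have "\<exists>F\<in>W. F \<noteq> (\<lambda>_. 0) \<and> (\<forall>s\<in>?S. \<exists>c. \<forall>x. F (s x) = c * F x)"
  proof (rule common_eigenfunction)
    fix s assume "s \<in> ?S"
    then have "bij s"
      by (auto intro!: finite_UNIV_inj_surj bijI injI simp: carrier)
    then show "\<exists>n>0. s ^^ n = id" by (rule bij_finite_order)
  qed (use W_nonzero in \<open>auto simp: o_def carrier m_lcomm intro: W_add W_scale W_closed\<close>)
  then obtain F where F: "F \<in> W" "F \<noteq> (\<lambda>_. 0)" and "\<And>g. \<exists>c. \<forall>x. F (g \<otimes>\<^bsub>G\<^esub> x) = c * F x"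
    by blast
  then obtain c where c: "\<And>g x. F (g \<otimes>\<^bsub>G\<^esub> x) = c g * F x" by metis
  have F_eq: "F g = c g * F \<one>\<^bsub>G\<^esub>" for g
    using c[of g "\<one>\<^bsub>G\<^esub>"] by (simp add: carrier)
  have "F \<one>\<^bsub>G\<^esub> \<noteq> 0"
  proof
    assume "F \<one>\<^bsub>G\<^esub> = 0"
    then have "F g = 0" for g using F_eq[of g] by simp
    then show False using F(2) by auto
  qed
  \<comment> \<open>Normalizing \<open>F\<close> at the identity recovers the eigenvalues, so they
    lie in \<open>W\<close> by \<open>W_scale\<close>.\<close>
  then have "c = (\<lambda>x. inverse (F \<one>\<^bsub>G\<^esub>) * F x)"
    by (intro ext, subst F_eq) simp
  then have "c \<in> W" using W_scale[OF F(1)] by simp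
  moreover have mult: "c (g \<otimes>\<^bsub>G\<^esub> h) = c g * c h" for g h
  proof -
    have "c (g \<otimes>\<^bsub>G\<^esub> h) * F \<one>\<^bsub>G\<^esub> = c g * c h * F \<one>\<^bsub>G\<^esub>"
      using c[of g h] F_eq[of h] F_eq[of "g \<otimes>\<^bsub>G\<^esub> h"] by (simp add: mult.assoc)
    then show ?thesis using \<open>F \<one>\<^bsub>G\<^esub> \<noteq> 0\<close> by simp
  qed
  moreover have "c g \<noteq> 0" for g
  proof
    assume "c g = 0"
    then have "c (g \<otimes>\<^bsub>G\<^esub> inv\<^bsub>G\<^esub> g) = 0" by (simp add: mult)
    then have "F \<one>\<^bsub>G\<^esub> = 0" using F_eq[of "\<one>\<^bsub>G\<^esub>"] by (simp add: carrier)
    then show False using \<open>F \<one>\<^bsub>G\<^esub> \<noteq> 0\<close> by simp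
  qed
  ultimately show ?thesis by (auto simp: hom_def complex_units_def)
qed

lemma character_pow_order:
  fixes G :: "('g, 'm) monoid_scheme"
  assumes "group G" "f \<in> hom G complex_units" "x \<in> carrier G"
  shows "f x ^ order G = 1"
proof -
  interpret group G by fact
  have mult: "f (a \<otimes>\<^bsub>G\<^esub> b) = f a * f b" "f a \<noteq> 0" if "a \<in> carrier G" "b \<in> carrier G" for a b
    using assms(2) that by (auto simp: hom_def complex_units_def)
  have one: "f \<one>\<^bsub>G\<^esub> = 1" using mult[of "\<one>\<^bsub>G\<^esub>" "\<one>\<^bsub>G\<^esub>"] by simp
  have "f (x [^]\<^bsub>G\<^esub> n) = f x ^ n" for n :: nat
    by (induction n) (use assms(3) in \<open>auto simp: one mult mult_ac\<close>)
  then show ?thesis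
    by (metis one assms(3) pow_order_eq_1)
qed

lemma norm_character:
  fixes G :: "('g::finite, 'm) monoid_scheme"
  assumes "group G" "f \<in> hom G complex_units" "x \<in> carrier G"
  shows "cmod (f x) = 1"
proof -
  interpret group G by fact
  have "order G > 0" using order_gt_0_iff_finite finite by blast
  then show ?thesis
    using power_eq_1_iff[OF character_pow_order[OF assms]] by simp
qed

section \<open>Characters of the additive group and their orthogonality relations\<close>

definition add_group :: "'a::ab_group_add monoid" where
  "add_group = \<lparr>carrier = UNIV, mult = (+), one = 0\<rparr>"

definition dual :: "('a::ab_group_add \<Rightarrow> complex) set" where
  "dual = hom add_group complex_units"

lemma comm_group_add_group: "comm_group (add_group :: 'a::ab_group_add monoid)"
proof (rule comm_groupI)
  fix x :: 'a
  show "\<exists>y\<in>carrier add_group. y \<otimes>\<^bsub>add_group\<^esub> x = \<one>\<^bsub>add_group\<^esub>"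
    by (auto simp: add_group_def intro: exI[of _ "-x"])
qed (auto simp: add_group_def add_ac)

lemma dual_iff:
  "\<phi> \<in> dual \<longleftrightarrow> (\<forall>x. \<phi> x \<noteq> 0) \<and> (\<forall>x y. \<phi> (x + y) = \<phi> x * \<phi> y)"
  by (auto simp: dual_def add_group_def hom_def complex_units_def)

lemma dual_nonzero: "\<phi> \<in> dual \<Longrightarrow> \<phi> x \<noteq> 0"
  and dual_add: "\<phi> \<in> dual \<Longrightarrow> \<phi> (x + y) = \<phi> x * \<phi> y"
  by (auto simp: dual_iff)

lemma dual_zero: "\<phi> \<in> dual \<Longrightarrow> \<phi> 0 = 1"
  using dual_add[of \<phi> 0 0] dual_nonzero[of \<phi> 0] by simp

lemma one_in_dual: "(\<lambda>_. 1) \<in> dual"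
  by (simp add: dual_iff)

lemma mult_in_dual: "\<phi> \<in> dual \<Longrightarrow> \<psi> \<in> dual \<Longrightarrow> (\<lambda>x. \<phi> x * \<psi> x) \<in> dual"
  by (auto simp: dual_iff mult_ac)

lemma cnj_in_dual: "\<phi> \<in> dual \<Longrightarrow> (\<lambda>x. cnj (\<phi> x)) \<in> dual"
  by (auto simp: dual_iff)

lemma norm_dual: "\<phi> \<in> dual \<Longrightarrow> cmod (\<phi> x) = 1" for x :: "'a::{finite,ab_group_add}"
  unfolding dual_def
  by (rule norm_character[OF comm_group.axioms(2)[OF comm_group_add_group]])
    (auto simp: add_group_def)

lemma cnj_mult_self_norm_1: "cmod z = 1 \<Longrightarrow> cnj z * z = 1" "cmod z = 1 \<Longrightarrow> z * cnj z = 1"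
  by (simp_all add: mult.commute complex_norm_square[symmetric])

lemma cnj_dual_mult_eq_1_iff:
  fixes \<phi> \<psi> :: "'a::{finite,ab_group_add} \<Rightarrow> complex"
  assumes "\<phi> \<in> dual" "\<psi> \<in> dual"
  shows "cnj (\<phi> x) * \<psi> x = 1 \<longleftrightarrow> \<phi> x = \<psi> x"
  using cnj_mult_self_norm_1[OF norm_dual[OF assms(1)], of x]
  by (metis mult.assoc mult.commute mult_1)

text \<open>The values are roots of unity of order dividing \<open>CARD('a)\<close>, so there are
  only finitely many possible functions.\<close>

lemma finite_dual: "finite (dual :: ('a::{finite,ab_group_add} \<Rightarrow> complex) set)"
proof -
  have "dual \<subseteq> (UNIV :: 'a set) \<rightarrow>\<^sub>E {z::complex. z ^ CARD('a) = 1}"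
  proof
    fix \<phi> :: "'a \<Rightarrow> complex" assume "\<phi> \<in> dual"
    then have "\<phi> x ^ CARD('a) = 1" for x
      using character_pow_order[OF comm_group.axioms(2)[OF comm_group_add_group], of \<phi> x]
      by (simp add: dual_def order_def add_group_def)
    then show "\<phi> \<in> UNIV \<rightarrow>\<^sub>E {z. z ^ CARD('a) = 1}" by auto
  qed
  moreover have "finite {z::complex. z ^ CARD('a) = 1}"
    by (rule finite_roots_unity) (simp add: Suc_leI)
  ultimately show ?thesis
    by (meson finite_PiE finite finite_subset)
qed

text \<open>Translating the summation variable by some \<open>a\<close> with
  \<open>\<phi> a \<noteq> 1\<close> multiplies the sum by \<open>\<phi> a\<close>.\<close>

lemma sum_dual:
  fixes \<phi> :: "'a::{finite,ab_group_add} \<Rightarrow> complex"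
  assumes "\<phi> \<in> dual"
  shows "(\<Sum>x\<in>UNIV. \<phi> x) = (if \<phi> = (\<lambda>_. 1) then of_nat CARD('a) else 0)"
proof (cases "\<phi> = (\<lambda>_. 1)")
  case False
  then obtain a where a: "\<phi> a \<noteq> 1" by auto
  have "(\<Sum>x\<in>UNIV. \<phi> x) = (\<Sum>x\<in>UNIV. \<phi> (a + x))"
    by (rule sum.reindex_bij_betw[symmetric]) (simp add: bij_plus_right)
  also have "\<dots> = \<phi> a * (\<Sum>x\<in>UNIV. \<phi> x)"
    by (simp add: dual_add[OF assms] sum_distrib_left)
  finally show ?thesis using a False by simp
qed simp

text \<open>A character with value 1 at \<open>a\<close> is constant on the orbit of 0 under
  translation by \<open>a\<close>, so its sum over that orbit is nonzero. A character chosen among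
  the functions with vanishing orbit sums therefore separates \<open>a\<close> from 0.\<close>

lemma dual_separates:
  fixes a :: "'a::{finite,ab_group_add}"
  assumes "a \<noteq> 0"
  shows "\<exists>\<phi>\<in>dual. \<phi> a \<noteq> 1"
proof -
  have "bij ((+) a)" by (simp add: bij_plus_right)
  then obtain n where n: "n > 0" "((+) a) ^^ n = id"
    using bij_finite_order by blast
  let ?t = "\<lambda>i. ((+) a) ^^ i"
  define W where "W = {F :: 'a \<Rightarrow> complex. \<forall>x. (\<Sum>i<n. F (?t i x)) = 0}"
  \<comment> \<open>The difference of the point masses at \<open>- a\<close> and 0: its orbit sums
    telescope to zero, and it is nonzero because \<open>a \<noteq> 0\<close>.\<close>
  define F0 :: "'a \<Rightarrow> complex" where "F0 = (\<lambda>x. of_bool (a + x = 0) - of_bool (x = 0))"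
  have shift: "g + ?t i x = ?t i (g + x)" for g i x
    by (induction i) (auto simp: add_ac)
  have "\<exists>\<theta>\<in>W. \<theta> \<in> hom add_group complex_units"
  proof (rule exists_character_in[OF comm_group_add_group])
    show "F0 \<in> W"
    proof -
      have "(\<Sum>i<n. F0 (?t i x)) = (\<Sum>i<n. of_bool (?t (Suc i) x = 0) - of_bool (?t i x = 0))" for x
        by (simp add: F0_def)
      also have "\<dots> x = 0" for x
        using sum_lessThan_telescope[of "\<lambda>i. of_bool (?t i x = 0) :: complex" n] by (simp add: n)
      finally show ?thesis by (simp add: W_def)
    qed
    have "F0 0 \<noteq> 0" using assms by (simp add: F0_def)
    then show "F0 \<noteq> (\<lambda>_. 0)" by auto
  qed (auto simp: W_def add_group_def sum.distrib shift simp flip: sum_distrib_left)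
  then obtain \<theta> where \<theta>: "\<theta> \<in> W" "\<theta> \<in> dual" by (auto simp: dual_def)
  have "\<theta> a \<noteq> 1"
  proof
    assume "\<theta> a = 1"
    then have "\<theta> (?t i 0) = 1" for i
      by (induction i) (auto simp: dual_add[OF \<theta>(2)] dual_zero[OF \<theta>(2)])
    then show False using \<theta>(1) n by (auto simp: W_def dest!: spec[of _ 0])
  qed
  then show ?thesis using \<theta> by blast
qed

text \<open>Multiplication by a character \<open>\<psi>\<close> with
  \<open>\<psi> a \<noteq> 1\<close> permutes \<open>dual\<close> and scales the sum by
  \<open>\<psi> a\<close>.\<close>

lemma sum_over_dual_eq_0:
  fixes a :: "'a::{finite,ab_group_add}"
  assumes "a \<noteq> 0"
  shows "(\<Sum>\<phi>\<in>dual. \<phi> a) = 0"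
proof -
  obtain \<psi> :: "'a \<Rightarrow> complex" where \<psi>: "\<psi> \<in> dual" "\<psi> a \<noteq> 1" using dual_separates[OF assms] by blast
  let ?m = "\<lambda>\<phi> x. \<psi> x * \<phi> x"
  have inj: "inj_on ?m dual"
    by (rule inj_onI) (auto simp: fun_eq_iff dual_nonzero[OF \<psi>(1)])
  have "?m ` dual = dual"
    by (rule endo_inj_surj[OF finite_dual _ inj]) (auto intro: mult_in_dual \<psi>)
  then have "(\<Sum>\<phi>\<in>dual. \<phi> a) = (\<Sum>\<phi>\<in>?m ` dual. \<phi> a)" by simp
  also have "\<dots> = \<psi> a * (\<Sum>\<phi>\<in>dual. \<phi> a)"
    by (subst sum.reindex[OF inj]) (simp add: sum_distrib_left)
  finally show ?thesis using \<psi> by simp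
qed

text \<open>Double counting of the sum of \<open>\<phi> a\<close> over all pairs: summing over
  \<open>\<phi>\<close> first leaves only \<open>a = 0\<close>, summing over \<open>a\<close> first
  leaves only the trivial character.\<close>

lemma card_dual: "card (dual :: ('a::{finite,ab_group_add} \<Rightarrow> complex) set) = CARD('a)"
proof -
  let ?D = "dual :: ('a \<Rightarrow> complex) set"
  have "(\<Sum>a\<in>UNIV. \<Sum>\<phi>\<in>?D. \<phi> a) = (\<Sum>a::'a\<in>UNIV. if a = 0 then \<Sum>\<phi>\<in>?D. \<phi> 0 else 0)"
    by (rule sum.cong) (auto simp: sum_over_dual_eq_0)
  also have "\<dots> = of_nat (card ?D)"
    by (simp add: dual_zero)
  finally have "of_nat (card ?D) = (\<Sum>\<phi>\<in>?D. \<Sum>a\<in>UNIV. \<phi> a)"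
    by (subst sum.swap) simp
  also have "\<dots> = (\<Sum>\<phi>\<in>?D. if \<phi> = (\<lambda>_. 1) then of_nat CARD('a) else 0)"
    by (rule sum.cong) (auto simp: sum_dual)
  also have "\<dots> = (of_nat CARD('a) :: complex)"
    by (simp add: finite_dual one_in_dual)
  finally show ?thesis using of_nat_eq_iff by blast
qed

lemma sum_over_dual:
  fixes a :: "'a::{finite,ab_group_add}"
  shows "(\<Sum>\<phi>\<in>dual. \<phi> a) = (if a = 0 then of_nat CARD('a) else 0)"
  using sum_over_dual_eq_0[of a] by (simp add: dual_zero card_dual)

section \<open>Weyl matrices\<close>

text \<open>The phase \<open>\<phi>\<close> may be any function, so that products and adjoints keep
  this form without hypotheses.\<close>

definition weyl :: "('a::{finite,ab_group_add} \<Rightarrow> complex) \<Rightarrow> 'a \<Rightarrow> complex ^ ('a::{finite,ab_group_add}) ^ ('a::{finite,ab_group_add})" where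
  "weyl \<phi> v = (\<chi> i j. if j = i + v then \<phi> i else 0)"

lemma weyl_vector_mult: "(weyl \<phi> v *v x) $ i = \<phi> i * x $ (i + v)"
  by (simp add: weyl_def matrix_vector_mult_def if_distrib[of "\<lambda>y. y * _"] cong: if_cong)

lemma weyl_mult: "weyl \<phi> v ** weyl \<psi> w = weyl (\<lambda>i. \<phi> i * \<psi> (i + v)) (v + w)"
  by (simp add: weyl_def matrix_matrix_mult_def vec_eq_iff add.assoc
      if_distrib[of "\<lambda>y. y * _"] cong: if_cong)

lemma adjoint_weyl: "adjoint_matrix (weyl \<phi> v) = weyl (\<lambda>i. cnj (\<phi> (i - v))) (- v)"
  by (auto simp: weyl_def adjoint_matrix_def vec_eq_iff)

lemma weyl_one: "weyl (\<lambda>_. 1) 0 = mat 1"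
  by (auto simp: weyl_def mat_def vec_eq_iff)

lemma unitary_weyl:
  assumes "\<phi> \<in> dual"
  shows "unitary_matrix (weyl \<phi> v)"
  using weyl_one
  by (simp add: unitary_matrix_def adjoint_weyl weyl_mult cnj_mult_self_norm_1 norm_dual[OF assms])

lemma weyl_eq_iff:
  assumes "\<phi> \<in> dual" "\<psi> \<in> dual"
  shows "weyl \<phi> v = weyl \<psi> w \<longleftrightarrow> \<phi> = \<psi> \<and> v = w"
proof
  assume eq: "weyl \<phi> v = weyl \<psi> w"
  have entry: "weyl \<phi> v $ i $ j = weyl \<psi> w $ i $ j" for i j by (simp add: eq)
  \<comment> \<open>Row 0 has its only nonzero entry in the column given by the shift.\<close>
  have "v = w"
    using entry[of 0 v] dual_nonzero[OF assms(1), of 0] by (simp add: weyl_def split: if_splits)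
  moreover have "\<phi> i = \<psi> i" for i
    using entry[of i "i + v"] \<open>v = w\<close> by (simp add: weyl_def)
  ultimately show "\<phi> = \<psi> \<and> v = w" by auto
qed simp

lemma weyl_eq_one_iff: "\<phi> \<in> dual \<Longrightarrow> weyl \<phi> v = mat 1 \<longleftrightarrow> \<phi> = (\<lambda>_. 1) \<and> v = 0"
  using weyl_eq_iff[OF _ one_in_dual, of \<phi> v 0] by (simp add: weyl_one)

lemma monomial_weyl:
  assumes "\<phi> \<in> dual"
  shows "monomial_matrix (weyl \<phi> v)"
proof -
  have "\<exists>!i. weyl \<phi> v $ i $ j \<noteq> 0" for j
    by (rule ex1I[of _ "j - v"]) (auto simp: weyl_def dual_nonzero[OF assms] split: if_splits)
  then show ?thesis
    by (auto simp: monomial_matrix_def weyl_def dual_nonzero[OF assms])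
qed

text \<open>With different shifts the product has zero diagonal; with equal shifts the trace is the
  sum of a nontrivial character.\<close>

lemma trace_inner_weyl:
  fixes \<phi> \<psi> :: "'a::{finite,ab_group_add} \<Rightarrow> complex"
  assumes "\<phi> \<in> dual" "\<psi> \<in> dual" "weyl \<phi> v \<noteq> weyl \<psi> w"
  shows "trace_inner (weyl \<phi> v) (weyl \<psi> w) = 0"
proof -
  have tr: "trace (weyl \<theta> u) = (if u = 0 then (\<Sum>i\<in>UNIV. \<theta> i) else 0)" for \<theta> and u :: 'a
    by (simp add: trace_def weyl_def)
  \<comment> \<open>Removes the translation that \<open>adjoint_weyl\<close> puts into the
    phase.\<close>
  have "(\<Sum>i\<in>UNIV. cnj (\<phi> (i - v)) * \<psi> (i - v)) = (\<Sum>i\<in>UNIV. cnj (\<phi> i) * \<psi> i)"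
    by (rule sum.reindex_bij_witness[of _ "\<lambda>i. i + v" "\<lambda>i. i - v"]) auto
  also have "\<dots> = 0" if "v = w"
  proof -
    have "\<phi> \<noteq> \<psi>" using assms(3) that by auto
    then have "(\<lambda>i. cnj (\<phi> i) * \<psi> i) \<noteq> (\<lambda>_. 1)"
      using cnj_dual_mult_eq_1_iff[OF assms(1,2)] by (auto simp: fun_eq_iff)
    then show ?thesis
      using sum_dual[OF mult_in_dual[OF cnj_in_dual[OF assms(1)] assms(2)]] by simp
  qed
  finally show ?thesis
    by (auto simp: trace_inner_def adjoint_weyl weyl_mult tr)
qed

section \<open>Bases from the characters of H\<close>

lemma cinner_commute: "cinner y x = cnj (cinner x y)"
  by (simp add: cinner_def mult.commute)

lemma mutually_unbiased_commute: "mutually_unbiased B B' \<Longrightarrow> mutually_unbiased B' B"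
  unfolding mutually_unbiased_def by (metis cinner_commute complex_mod_cnj)

lemma span_eq_UNIV_I:
  fixes B :: "(complex ^ 'n) set"
  assumes "\<And>i. axis i 1 \<in> vec.span B"
  shows "vec.span B = UNIV"
proof -
  have "x \<in> vec.span B" for x
    by (subst basis_expansion[symmetric]) (intro vec.span_sum vec.span_scale assms)
  then show ?thesis by auto
qed

lemma orthonormal_standard_basis: "orthonormal_basis (standard_basis :: (complex ^ 'n) set)"
proof -
  have "cinner (axis i 1) (axis j 1) = (if i = j then 1 else 0)" for i j :: 'n
    by (simp add: cinner_def axis_def if_distrib[of cnj] if_distrib[of "\<lambda>y. y * _"] cong: if_cong)
  then show ?thesis
    by (auto simp: orthonormal_basis_def standard_basis_def axis_eq_axis
        intro!: span_eq_UNIV_I intro: vec.span_base)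
qed

text \<open>Lets the semifield bases themselves serve as the equivalent set in
  \<open>monomial_mubs\<close>.\<close>

lemma mub_equivalent_refl:
  fixes \<B> :: "(complex ^ 'n) set set"
  shows "mub_equivalent \<B> \<B>"
proof -
  have "adjoint_matrix (mat 1) = (mat 1 :: complex ^ 'n ^ 'n)"
    by (simp add: adjoint_matrix_def mat_def vec_eq_iff)
  then have "unitary_matrix (mat 1 :: complex ^ 'n ^ 'n)"
    by (simp add: unitary_matrix_def)
  moreover have "(*v) (mat 1 :: complex ^ 'n ^ 'n) = (\<lambda>x. x)"
    by auto
  ultimately show ?thesis
    unfolding mub_equivalent_def by (intro exI[of _ "mat 1"]) simp
qed

context finite_commutative_semifield
begin

section \<open>Semifield multiplication and the characters of H\<close>

lemma mul_zero_left: "mul 0 x = 0"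
  using distrib_right[of 0 0 x] by simp

lemma mul_zero_right: "mul x 0 = 0"
  using mul_zero_left[of x] by (simp add: mul_commute)

text \<open>Multiplication by \<open>v\<close> is additive with trivial kernel, since there are no
  zero divisors; finiteness gives surjectivity.\<close>

lemma bij_mul:
  assumes "v \<noteq> 0"
  shows "bij (\<lambda>u. mul u v)"
proof -
  have "inj (\<lambda>u. mul u v)"
  proof (rule injI)
    fix x y assume "mul x v = mul y v"
    moreover have "mul x v = mul (x - y) v + mul y v"
      by (simp flip: distrib_right)
    ultimately have "mul (x - y) v = 0" by simp
    with mul_eq_0 assms show "x = y" by fastforce
  qed
  then show ?thesis by (simp add: bij_def finite_UNIV_inj_surj)
qed

lemma dual_mul:
  assumes "\<phi> \<in> dual"
  shows "(\<lambda>u. \<phi> (mul u v)) \<in> dual"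
  using assms by (simp add: dual_iff distrib_right)

lemma dual_mul_eq_iff:
  assumes "v \<noteq> 0"
  shows "(\<lambda>u. \<phi> (mul u v)) = (\<lambda>u. \<psi> (mul u v)) \<longleftrightarrow> \<phi> = \<psi>"
  using bij_mul[OF assms] by (auto simp: fun_eq_iff bij_def surj_def) metis

lemma comm_group_H: "comm_group (H_group mul)"
proof (rule comm_groupI)
  fix x :: "'a \<times> 'a"
  obtain u b where x: "x = (u, b)" by force
  have "mul (- u) u + mul u u = 0"
    by (simp add: mul_zero_left flip: distrib_right)
  then show "\<exists>y\<in>carrier (H_group mul). y \<otimes>\<^bsub>H_group mul\<^esub> x = \<one>\<^bsub>H_group mul\<^esub>"
    \<comment> \<open>The second coordinate of the inverse compensates for
      \<open>mul (- u) u = - mul u u\<close>.\<close>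
    by (intro bexI[of _ "(- u, mul u u - b)"]) (auto simp: H_group_def x add_ac)
qed (auto simp: H_group_def distrib_left distrib_right mul_zero_left mul_zero_right mul_commute add_ac)

abbreviation H_characters :: "('a \<times> 'a \<Rightarrow> complex) set" where
  "H_characters \<equiv> hom (H_group mul) complex_units"

lemma H_character_iff:
  "f \<in> H_characters \<longleftrightarrow>
     (\<forall>x. f x \<noteq> 0) \<and> (\<forall>u b v d. f (u + v, b + d + mul u v) = f (u, b) * f (v, d))"
  by (auto simp: H_group_def hom_def complex_units_def)

lemma H_character_nonzero: "f \<in> H_characters \<Longrightarrow> f x \<noteq> 0"
  and H_character_mult: "f \<in> H_characters \<Longrightarrow> f (u + v, b + d + mul u v) = f (u, b) * f (v, d)"
  unfolding H_character_iff by blast+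

lemma H_character_split: "f \<in> H_characters \<Longrightarrow> f (u, b) = f (u, 0) * f (0, b)"
  using H_character_mult[of f u 0 0 b] by (simp add: mul_zero_right)

text \<open>The product of \<open>(u, 0)\<close> and \<open>(v, 0)\<close> is
  \<open>(u + v, mul u v)\<close>, whose second coordinate splits off. This quadratic relation
  yields both the Gauss sums and the eigenvector equation.\<close>

lemma H_character_add:
  "f \<in> H_characters \<Longrightarrow> f (u + v, 0) * f (0, mul u v) = f (u, 0) * f (v, 0)"
  using H_character_mult[of f u v 0 0] H_character_split[of f "u + v" "mul u v"] by simp

lemma norm_H_character: "f \<in> H_characters \<Longrightarrow> cmod (f x) = 1"
  by (rule norm_character[OF comm_group.axioms(2)[OF comm_group_H]]) (auto simp: H_group_def)

lemma H_character_restrict_dual: "f \<in> H_characters \<Longrightarrow> (\<lambda>b. f (0, b)) \<in> dual"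
  using H_character_mult[of f 0 0] by (auto simp: dual_iff mul_zero_left H_character_nonzero)

lemma H_character_trivial_dual:
  assumes "f \<in> H_characters" "\<And>b. f (0, b) = 1"
  shows "(\<lambda>u. f (u, 0)) \<in> dual"
  using H_character_add[OF assms(1)] H_character_nonzero[OF assms(1)] assms(2) by (auto simp: dual_iff)

lemma mult_H_character:
  "f \<in> H_characters \<Longrightarrow> g \<in> H_characters \<Longrightarrow> (\<lambda>x. f x * g x) \<in> H_characters"
  by (auto simp: H_character_iff mult_ac)

lemma cnj_H_character: "f \<in> H_characters \<Longrightarrow> (\<lambda>x. cnj (f x)) \<in> H_characters"
  by (auto simp: H_character_iff)

lemma dual_fst_H_character: "\<psi> \<in> dual \<Longrightarrow> (\<lambda>x. \<psi> (fst x)) \<in> H_characters"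
  by (auto simp: H_character_iff dual_iff)

text \<open>Extension from \<open>N\<close> to the whole group: \<open>W\<close> consists of the
  functions that transform by \<open>\<phi>\<close> under \<open>N\<close>, and a character in
  \<open>W\<close> restricts to \<open>\<phi>\<close> because its value at the identity is
  1.\<close>

lemma exists_H_character:
  assumes "\<phi> \<in> dual"
  shows "\<exists>f\<in>H_characters. \<forall>b. f (0, b) = \<phi> b"
proof -
  define W where "W = {F :: 'a \<times> 'a \<Rightarrow> complex. \<forall>u b d. F (u, b + d) = \<phi> d * F (u, b)}"
  have "\<exists>f\<in>W. f \<in> H_characters"
  proof (rule exists_character_in[OF comm_group_H])
    show "(\<lambda>x. \<phi> (snd x)) \<in> W"
      by (simp add: W_def dual_add[OF assms])
    show "(\<lambda>x. \<phi> (snd x)) \<noteq> (\<lambda>_. 0)"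
      by (auto simp: fun_eq_iff dual_nonzero[OF assms])
    fix F and g :: "'a \<times> 'a" assume F: "F \<in> W"
    obtain w c where g: "g = (w, c)" by force
    have "F (w + u, c + (b + d) + mul w u) = \<phi> d * F (w + u, c + b + mul w u)" for u b d
    proof -
      \<comment> \<open>\<open>N\<close> is central, so translating by \<open>g\<close> does not
        disturb the transformation rule.\<close>
      have "c + (b + d) + mul w u = (c + b + mul w u) + d" by (simp add: add_ac)
      moreover have "F (w + u, (c + b + mul w u) + d) = \<phi> d * F (w + u, c + b + mul w u)"
        using F unfolding W_def by blast
      ultimately show ?thesis by (simp only:)
    qed
    then show "(\<lambda>x. F (g \<otimes>\<^bsub>H_group mul\<^esub> x)) \<in> W"
      by (simp add: W_def g H_group_def)
  qed (auto simp: W_def H_group_def algebra_simps)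
  then obtain f where f: "f \<in> W" "f \<in> H_characters" by blast
  have "f (0, 0) = 1"
    using H_character_restrict_dual[OF f(2)] dual_zero by blast
  moreover have "f (0, 0 + b) = \<phi> b * f (0, 0)" for b
    using f(1) unfolding W_def by blast
  ultimately have "f (0, b) = \<phi> b" for b
    by simp
  then show ?thesis using f(2) by blast
qed

section \<open>Cosets as fibers of restriction to N, and the bases they give\<close>

definition fiber :: "('a \<Rightarrow> complex) \<Rightarrow> ('a \<times> 'a \<Rightarrow> complex) set" where
  "fiber \<phi> = {f \<in> H_characters. \<forall>b. f (0, b) = \<phi> b}"

text \<open>Two characters lie in the same coset exactly when their quotient is trivial on
  \<open>N\<close>; the conjugate serves as inverse because values have modulus 1.\<close>

lemma rcoset_H0_star:
  assumes f: "f \<in> H_characters"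
  shows "H0_star mul #>\<^bsub>character_group (H_group mul)\<^esub> f = fiber (\<lambda>b. f (0, b))"
proof -
  have H0: "h \<in> H0_star mul \<longleftrightarrow> h \<in> H_characters \<and> (\<forall>b. h (0, b) = 1)" for h
    by (auto simp: H0_star_def N_subgroup_def character_group_def)
  have coset: "H0_star mul #>\<^bsub>character_group (H_group mul)\<^esub> f = (\<lambda>h x. h x * f x) ` H0_star mul"
    by (auto simp: r_coset_def character_group_def)
  show ?thesis unfolding coset
  proof (intro equalityI subsetI)
    fix g assume "g \<in> (\<lambda>h x. h x * f x) ` H0_star mul"
    then show "g \<in> fiber (\<lambda>b. f (0, b))"
      using f by (auto simp: H0 fiber_def intro: mult_H_character)
  next
    fix g assume g: "g \<in> fiber (\<lambda>b. f (0, b))"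
    let ?h = "\<lambda>x. g x * cnj (f x)"
    have "g = (\<lambda>x. ?h x * f x)"
      by (auto simp: mult.assoc cnj_mult_self_norm_1 norm_H_character[OF f])
    moreover have "?h \<in> H0_star mul"
      using g f by (auto simp: H0 fiber_def cnj_mult_self_norm_1 norm_H_character[OF f]
          intro: mult_H_character cnj_H_character)
    ultimately show "g \<in> (\<lambda>h x. h x * f x) ` H0_star mul" by (rule image_eqI)
  qed
qed

definition fiber_basis :: "('a \<Rightarrow> complex) \<Rightarrow> (complex, 'a) vec set" where
  "fiber_basis \<phi> = restricted_character ` fiber \<phi>"

lemma semifield_bases_eq: "semifield_bases mul = insert standard_basis (fiber_basis ` dual)"
proof -
  have "rcosets\<^bsub>character_group (H_group mul)\<^esub> H0_star mul = (\<lambda>f. fiber (\<lambda>b. f (0, b))) ` H_characters"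
    using rcoset_H0_star by (auto simp: RCOSETS_def character_group_def)
  also have "\<dots> = fiber ` dual"
  proof (intro equalityI subsetI)
    fix K assume "K \<in> fiber ` dual"
    then obtain \<phi> where \<phi>: "\<phi> \<in> dual" "K = fiber \<phi>" by blast
    obtain f where "f \<in> H_characters" "\<forall>b. f (0, b) = \<phi> b"
      using exists_H_character[OF \<phi>(1)] by blast
    then show "K \<in> (\<lambda>f. fiber (\<lambda>b. f (0, b))) ` H_characters"
      using \<phi>(2) by (intro image_eqI[of _ _ f]) auto
  qed (auto intro: H_character_restrict_dual)
  finally show ?thesis
    by (simp add: semifield_bases_def fiber_basis_def image_image)
qed

lemma restricted_character_nth:
  "restricted_character f $ u = f (u, 0) / complex_of_real (sqrt (real CARD('a)))"
  for f :: "'a \<times> 'a \<Rightarrow> complex"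
  by (simp add: restricted_character_def)

text \<open>Restriction to \<open>H\<^sub>0\<close> loses nothing: as \<open>mul u unit = u\<close>,
  the relation \<open>H_character_add\<close> with \<open>v = unit\<close> recovers the values on
  \<open>N\<close>.\<close>

lemma fiber_basis_disjoint:
  assumes "x \<in> fiber_basis \<phi>" "x \<in> fiber_basis \<psi>"
  shows "\<phi> = \<psi>"
proof -
  obtain f g where f: "f \<in> fiber \<phi>" "x = restricted_character f"
    and g: "g \<in> fiber \<psi>" "x = restricted_character g"
    using assms by (auto simp: fiber_basis_def)
  have eq: "f (u, 0) = g (u, 0)" for u
    using arg_cong[of _ _ "\<lambda>x. x $ u", OF trans[OF f(2)[symmetric] g(2)]]
    by (simp add: restricted_character_nth)
  have fg: "f \<in> H_characters" "g \<in> H_characters" using f(1) g(1) by (auto simp: fiber_def)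
  have "g (u + unit, 0) * f (0, u) = g (u + unit, 0) * g (0, u)" for u
    using H_character_add[OF fg(1), of u unit] H_character_add[OF fg(2), of u unit]
    by (simp add: eq unit_right)
  then have "f (0, u) = g (0, u)" for u
    using H_character_nonzero[OF fg(2)] by (meson mult_left_cancel)
  then show ?thesis using f(1) g(1) by (auto simp: fiber_def)
qed

lemma fiber_nonempty: "\<phi> \<in> dual \<Longrightarrow> \<exists>f. f \<in> fiber \<phi>"
  using exists_H_character by (auto simp: fiber_def)

lemma inj_on_fiber_basis: "inj_on fiber_basis dual"
proof (rule inj_onI)
  fix \<phi> \<psi> assume "\<phi> \<in> dual" and eq: "fiber_basis \<phi> = fiber_basis \<psi>"
  then obtain f where "f \<in> fiber \<phi>"
    using fiber_nonempty by blast
  then obtain x where "x \<in> fiber_basis \<phi>"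
    unfolding fiber_basis_def by blast
  then show "\<phi> = \<psi>" using eq fiber_basis_disjoint by blast
qed

text \<open>Restricted characters have no zero coordinate, whereas \<open>axis i 1\<close> vanishes
  at \<open>i + unit\<close>.\<close>

lemma fiber_basis_neq_standard_basis:
  assumes "\<phi> \<in> dual"
  shows "fiber_basis \<phi> \<noteq> standard_basis"
proof
  assume eq: "fiber_basis \<phi> = standard_basis"
  obtain f where f: "f \<in> fiber \<phi>" using fiber_nonempty[OF assms] by blast
  then have "restricted_character f \<in> standard_basis"
    using eq by (auto simp: fiber_basis_def)
  then obtain i where i: "restricted_character f = axis i 1"
    by (auto simp: standard_basis_def)
  have "f (i + unit, 0) = 0"
    using arg_cong[OF i, of "\<lambda>x. x $ (i + unit)"] unit_neq_0
    by (simp add: restricted_character_nth axis_def)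
  then show False using f H_character_nonzero by (auto simp: fiber_def)
qed

lemma cinner_restricted_character:
  fixes f g :: "'a \<times> 'a \<Rightarrow> complex"
  shows "cinner (restricted_character f) (restricted_character g) =
    (\<Sum>u\<in>UNIV. cnj (f (u, 0)) * g (u, 0)) / of_nat CARD('a)"
proof -
  have "complex_of_real (sqrt (real CARD('a))) * complex_of_real (sqrt (real CARD('a))) = of_nat CARD('a)"
    by (simp flip: of_real_mult)
  then show ?thesis
    by (simp add: cinner_def restricted_character_nth sum_divide_distrib)
qed

lemma orthonormal_fiber_basis:
  assumes "\<phi> \<in> dual"
  shows "orthonormal_basis (fiber_basis \<phi>)"
  unfolding orthonormal_basis_def
proof (intro conjI ballI)
  fix x y assume "x \<in> fiber_basis \<phi>" "y \<in> fiber_basis \<phi>"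
  then obtain f g where f: "f \<in> H_characters" "\<And>b. f (0, b) = \<phi> b"
    and g: "g \<in> H_characters" "\<And>b. g (0, b) = \<phi> b"
    and xy: "x = restricted_character f" "y = restricted_character g"
    by (auto simp: fiber_basis_def fiber_def)
  let ?h = "\<lambda>u. cnj (f (u, 0)) * g (u, 0)"
  \<comment> \<open>Both characters restrict to \<open>\<phi>\<close> on \<open>N\<close>, so
    \<open>cnj f\<close> times \<open>g\<close> is trivial there and descends to a character of the
    additive group.\<close>
  have "?h \<in> dual"
    using H_character_trivial_dual[OF mult_H_character[OF cnj_H_character[OF f(1)] g(1)]]
    by (simp add: f g cnj_mult_self_norm_1 norm_dual[OF assms])
  moreover have "?h u = 1 \<longleftrightarrow> f (u, 0) = g (u, 0)" for u
    using cnj_mult_self_norm_1[OF norm_H_character[OF f(1)], of "(u, 0)"]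
    by (metis mult.assoc mult.commute mult_1)
  then have "?h = (\<lambda>_. 1) \<longleftrightarrow> x = y"
    by (simp add: fun_eq_iff xy vec_eq_iff restricted_character_nth)
  ultimately show "cinner x y = (if x = y then 1 else 0)"
    unfolding xy(1,2) cinner_restricted_character by (simp add: sum_dual xy)
next
  show "vec.span (fiber_basis \<phi>) = UNIV"
  proof (rule span_eq_UNIV_I)
    fix u :: 'a
    obtain f where f: "f \<in> H_characters" "\<And>b. f (0, b) = \<phi> b"
      using exists_H_character[OF assms] by blast
    \<comment> \<open>Twisting \<open>f\<close> by characters of the first coordinate stays inside
      the fiber; Fourier inversion over \<open>dual\<close> then isolates the coordinate
      \<open>u\<close>.\<close>
    let ?g = "\<lambda>\<psi> x. f x * \<psi> (fst x)"
    let ?r = "complex_of_real (sqrt (real CARD('a)))"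
    have g: "restricted_character (?g \<psi>) \<in> fiber_basis \<phi>" if "\<psi> \<in> dual" for \<psi>
      using f that mult_H_character[OF f(1) dual_fst_H_character[OF that]]
      by (auto simp: fiber_basis_def fiber_def dual_zero)
    have rr: "?r * ?r = of_nat CARD('a)" by (simp flip: of_real_mult)
    have "(\<Sum>\<psi>\<in>dual. (cnj (?g \<psi> (u, 0)) / ?r) *s restricted_character (?g \<psi>)) $ v = axis u 1 $ v" for v
    proof -
      have "(\<Sum>\<psi>\<in>dual. (cnj (?g \<psi> (u, 0)) / ?r) *s restricted_character (?g \<psi>)) $ v
          = (\<Sum>\<psi>\<in>dual. cnj (f (u, 0)) * f (v, 0) / (?r * ?r) * (cnj (\<psi> u) * \<psi> v))"
        by (simp add: restricted_character_nth mult_ac)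
      also have "\<dots> = cnj (f (u, 0)) * f (v, 0) / (?r * ?r) * (\<Sum>\<psi>\<in>dual. \<psi> (v - u))"
        unfolding sum_distrib_left[symmetric]
      proof (intro arg_cong[of _ _ "(*) _"] sum.cong refl)
        fix \<psi> :: "'a \<Rightarrow> complex" assume \<psi>: "\<psi> \<in> dual"
        have "\<psi> v = \<psi> u * \<psi> (v - u)" by (simp flip: dual_add[OF \<psi>])
        then show "cnj (\<psi> u) * \<psi> v = \<psi> (v - u)"
          using cnj_mult_self_norm_1[OF norm_dual[OF \<psi>, of u]] by (simp flip: mult.assoc)
      qed
      also have "\<dots> = axis u 1 $ v"
        unfolding rr sum_over_dual
        using cnj_mult_self_norm_1[OF norm_H_character[OF f(1), of "(u, 0)"]]
        by (simp add: axis_def)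
      finally show ?thesis .
    qed
    then have "axis u 1 = (\<Sum>\<psi>\<in>dual. (cnj (?g \<psi> (u, 0)) / ?r) *s restricted_character (?g \<psi>))"
      by (simp add: vec_eq_iff)
    also have "\<dots> \<in> vec.span (fiber_basis \<phi>)"
      by (intro vec.span_sum vec.span_scale vec.span_base g)
    finally show "axis u 1 \<in> vec.span (fiber_basis \<phi>)" .
  qed
qed

section \<open>Gauss sums and mutual unbiasedness\<close>

text \<open>The classical Gauss sum computation: in the squared modulus put
  \<open>v = u + w\<close>. For fixed \<open>w\<close> the sum over \<open>u\<close> is then a
  nontrivial character sum along \<open>mul u w\<close>, which vanishes unless
  \<open>w = 0\<close>.\<close>

lemma norm_sum_H_character:
  assumes h: "h \<in> H_characters" and "h (0, a) \<noteq> 1"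
  shows "cmod (\<Sum>u\<in>UNIV. h (u, 0)) = sqrt (real CARD('a))"
proof -
  let ?\<phi> = "\<lambda>b. h (0, b)" and ?S = "\<Sum>u\<in>UNIV. h (u, 0)"
  have \<phi>: "?\<phi> \<in> dual" by (rule H_character_restrict_dual[OF h])
  have shift: "cnj (h (u, 0)) * h (u + w, 0) = h (w, 0) * cnj (?\<phi> (mul u w))" for u w
  proof -
    have "h (u + w, 0) * (?\<phi> (mul u w) * cnj (?\<phi> (mul u w))) = h (u, 0) * h (w, 0) * cnj (?\<phi> (mul u w))"
      using H_character_add[OF h, of u w] by (simp flip: mult.assoc)
    then have "h (u + w, 0) = h (u, 0) * h (w, 0) * cnj (?\<phi> (mul u w))"
      by (simp add: cnj_mult_self_norm_1 norm_H_character[OF h])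
    then show ?thesis
      using cnj_mult_self_norm_1(1)[OF norm_H_character[OF h], of "(u, 0)"] by (simp flip: mult.assoc)
  qed
  have vanish: "(\<Sum>u\<in>UNIV. cnj (?\<phi> (mul u w))) = 0" if "w \<noteq> 0" for w
  proof -
    have "(\<Sum>u\<in>UNIV. cnj (?\<phi> (mul u w))) = (\<Sum>b\<in>UNIV. cnj (?\<phi> b))"
      \<comment> \<open>Multiplication by the nonzero \<open>w\<close> permutes the semifield, so
        \<open>w\<close> drops out.\<close>
      by (rule sum.reindex_bij_betw[OF bij_mul[OF that]])
    also have "\<dots> = cnj (\<Sum>b\<in>UNIV. ?\<phi> b)" by simp
    finally show ?thesis using sum_dual[OF \<phi>] assms(2) by (auto simp: fun_eq_iff)
  qed
  have "cnj ?S * ?S = (\<Sum>u\<in>UNIV. \<Sum>v\<in>UNIV. cnj (h (u, 0)) * h (v, 0))"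
    by (simp add: sum_product)
  also have "\<dots> = (\<Sum>u\<in>UNIV. \<Sum>w\<in>UNIV. cnj (h (u, 0)) * h (u + w, 0))"
    by (intro sum.cong refl sum.reindex_bij_betw[symmetric]) (simp add: bij_plus_right)
  also have "\<dots> = (\<Sum>w\<in>UNIV. h (w, 0) * (\<Sum>u\<in>UNIV. cnj (?\<phi> (mul u w))))"
    unfolding shift sum_distrib_left by (rule sum.swap)
  also have "\<dots> = (\<Sum>w::'a\<in>UNIV. if w = 0 then of_nat CARD('a) else 0)"
    by (rule sum.cong) (auto simp: vanish mul_zero_right dual_zero[OF \<phi>])
  finally have "cnj ?S * ?S = of_nat CARD('a)" by simp
  then have "(cmod ?S)\<^sup>2 = real CARD('a)"
    by (metis complex_norm_square mult.commute of_real_eq_iff of_real_of_nat_eq)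
  then show ?thesis by (metis norm_ge_zero real_sqrt_unique)
qed

text \<open>The inner product is a normalized Gauss sum of \<open>cnj f\<close> times
  \<open>g\<close>, a character of H that is nontrivial on \<open>N\<close> because
  \<open>\<phi>\<close> and \<open>\<psi>\<close> differ.\<close>

lemma mutually_unbiased_fiber_basis:
  assumes "\<phi> \<in> dual" "\<psi> \<in> dual" "\<phi> \<noteq> \<psi>"
  shows "mutually_unbiased (fiber_basis \<phi>) (fiber_basis \<psi>)"
  unfolding mutually_unbiased_def
proof (intro exI ballI)
  fix x y assume "x \<in> fiber_basis \<phi>" "y \<in> fiber_basis \<psi>"
  then obtain f g where f: "f \<in> H_characters" "\<And>b. f (0, b) = \<phi> b"
    and g: "g \<in> H_characters" "\<And>b. g (0, b) = \<psi> b"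
    and xy: "x = restricted_character f" "y = restricted_character g"
    by (auto simp: fiber_basis_def fiber_def)
  obtain a where a: "\<phi> a \<noteq> \<psi> a" using assms(3) by auto
  have "cmod (\<Sum>u\<in>UNIV. cnj (f (u, 0)) * g (u, 0)) = sqrt (real CARD('a))"
    using norm_sum_H_character[OF mult_H_character[OF cnj_H_character[OF f(1)] g(1)], of a]
      cnj_dual_mult_eq_1_iff[OF assms(1,2)] a by (simp add: f(2) g(2))
  then show "cmod (cinner x y) = sqrt (real CARD('a)) / real CARD('a)"
    by (simp add: xy cinner_restricted_character norm_divide)
qed

lemma mutually_unbiased_standard_fiber_basis:
  "mutually_unbiased standard_basis (fiber_basis \<phi>)"
  unfolding mutually_unbiased_def
proof (intro exI ballI)
  fix x y :: "(complex, 'a) vec" assume "x \<in> standard_basis" "y \<in> fiber_basis \<phi>"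
  then obtain i f where f: "f \<in> H_characters" and x: "x = axis i 1" and y: "y = restricted_character f"
    by (auto simp: fiber_basis_def fiber_def standard_basis_def)
  have "cinner x y = y $ i"
    by (simp add: x cinner_def axis_def if_distrib[of cnj] if_distrib[of "\<lambda>y. y * _"] cong: if_cong)
  then show "cmod (cinner x y) = 1 / sqrt (real CARD('a))"
    by (simp add: y restricted_character_nth norm_divide norm_H_character[OF f])
qed

lemma mub_set_semifield_bases: "mub_set (semifield_bases mul)"
  unfolding mub_set_def semifield_bases_eq
proof (intro conjI ballI impI)
  show "finite (insert standard_basis (fiber_basis ` dual))"
    by (simp add: finite_dual)
next
  fix B assume "B \<in> insert standard_basis (fiber_basis ` dual)"
  then show "orthonormal_basis B"
    by (auto intro: orthonormal_standard_basis orthonormal_fiber_basis)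
next
  fix B B' assume "B \<in> insert standard_basis (fiber_basis ` dual)"
    "B' \<in> insert standard_basis (fiber_basis ` dual)" "B \<noteq> B'"
  then show "mutually_unbiased B B'"
    by (auto intro: mutually_unbiased_standard_fiber_basis mutually_unbiased_fiber_basis
        mutually_unbiased_commute[OF mutually_unbiased_standard_fiber_basis])
qed

section \<open>The commuting classes of Weyl matrices\<close>

text \<open>The index \<open>None\<close> stands for the standard basis.\<close>

definition indexed_basis :: "('a \<Rightarrow> complex) option \<Rightarrow> (complex, 'a) vec set" where
  "indexed_basis k = (case k of None \<Rightarrow> standard_basis | Some \<phi> \<Rightarrow> fiber_basis \<phi>)"

definition weyl_class :: "('a \<Rightarrow> complex) option \<Rightarrow> ((complex, 'a) vec, 'a) vec set" where
  "weyl_class k = (case k of None \<Rightarrow> (\<lambda>\<phi>. weyl \<phi> 0) ` dual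
     | Some \<phi> \<Rightarrow> range (\<lambda>v. weyl (\<lambda>u. \<phi> (mul u v)) v))"

abbreviation class_indices :: "('a \<Rightarrow> complex) option set" where
  "class_indices \<equiv> insert None (Some ` dual)"

lemma card_class_indices: "card class_indices = CARD('a) + 1"
  by (simp add: finite_dual card_image card_dual)

lemma bij_betw_indexed_basis: "bij_betw indexed_basis class_indices (semifield_bases mul)"
  unfolding bij_betw_def semifield_bases_eq
proof
  show "inj_on indexed_basis class_indices"
    using fiber_basis_neq_standard_basis inj_on_fiber_basis
    by (auto simp: inj_on_def indexed_basis_def)
qed (auto simp: indexed_basis_def image_image)

text \<open>Reduces unitarity, trace orthogonality and monomiality of the classes to the facts about
  single Weyl matrices.\<close>

lemma weyl_class_is_weyl:
  assumes "k \<in> class_indices" "A \<in> weyl_class k"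
  shows "\<exists>\<phi>\<in>dual. \<exists>v. A = weyl \<phi> v"
  using assms by (auto simp: weyl_class_def) (blast intro: dual_mul)+

lemma one_in_weyl_class:
  assumes "k \<in> class_indices"
  shows "mat 1 \<in> weyl_class k"
proof -
  have "mat 1 = weyl (\<lambda>u. \<phi> (mul u 0)) 0" if "\<phi> \<in> dual" for \<phi> :: "'a \<Rightarrow> complex"
    by (simp add: mul_zero_right dual_zero[OF that] weyl_one)
  then show ?thesis
    using assms one_in_dual weyl_one[where 'a = 'a]
    by (force simp: weyl_class_def)
qed

lemma card_weyl_class:
  assumes "k \<in> class_indices"
  shows "card (weyl_class k) = CARD('a)"
proof (cases k)
  case None
  have "inj_on (\<lambda>\<phi>. weyl \<phi> (0::'a)) dual"
    by (auto intro!: inj_onI simp: weyl_eq_iff)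
  then show ?thesis by (simp add: weyl_class_def None card_image card_dual)
next
  case (Some \<phi>)
  then have "inj (\<lambda>v. weyl (\<lambda>u. \<phi> (mul u v)) v)"
    using assms by (auto intro!: injI simp: weyl_eq_iff dual_mul)
  then show ?thesis by (simp add: weyl_class_def Some card_image)
qed

text \<open>In a class \<open>Some \<phi>\<close>, the phase of the product for shifts
  \<open>v\<close> and \<open>w\<close> is \<open>\<phi>\<close> of
  \<open>mul u v + mul u w + mul v w\<close>, symmetric in \<open>v\<close> and \<open>w\<close>
  because \<open>mul\<close> is commutative.\<close>

lemma weyl_class_commute:
  assumes "k \<in> class_indices" "A \<in> weyl_class k" "B \<in> weyl_class k"
  shows "A ** B = B ** A"
proof (cases k)
  case None
  then show ?thesis using assms by (auto simp: weyl_class_def weyl_mult mult.commute)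
next
  case (Some \<phi>)
  then have \<phi>: "\<phi> \<in> dual" using assms by auto
  show ?thesis
    using assms Some
    by (auto simp: weyl_class_def weyl_mult distrib_left dual_add[OF \<phi>] mul_commute ac_simps)
qed

text \<open>A Weyl matrix determines its shift and character. A nonzero shift excludes the diagonal
  class and, by \<open>dual_mul_eq_iff\<close>, determines \<open>\<phi>\<close>; at shift 0 a class
  \<open>Some \<phi>\<close> contains only the identity.\<close>

lemma weyl_class_Int:
  assumes k: "k \<in> class_indices" and l: "l \<in> class_indices" and "k \<noteq> l"
  shows "weyl_class k \<inter> weyl_class l = {mat 1}"
proof -
  have None_Some: "weyl_class None \<inter> weyl_class (Some \<phi>) \<subseteq> {mat 1}" if "\<phi> \<in> dual" for \<phi>
    using that by (auto simp: weyl_class_def weyl_eq_iff dual_mul weyl_eq_one_iff mul_zero_right dual_zero)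
  have Some_Some: "weyl_class (Some \<phi>) \<inter> weyl_class (Some \<psi>) \<subseteq> {mat 1}"
    if neq: "\<phi> \<in> dual" "\<psi> \<in> dual" "\<phi> \<noteq> \<psi>" for \<phi> \<psi>
  proof
    fix A assume "A \<in> weyl_class (Some \<phi>) \<inter> weyl_class (Some \<psi>)"
    then obtain v where v: "A = weyl (\<lambda>u. \<phi> (mul u v)) v" "(\<lambda>u. \<phi> (mul u v)) = (\<lambda>u. \<psi> (mul u v))"
      using neq by (auto simp: weyl_class_def weyl_eq_iff dual_mul)
    then have "v = 0" using dual_mul_eq_iff neq(3) by blast
    then show "A \<in> {mat 1}"
      using neq by (simp add: v(1) mul_zero_right dual_zero weyl_one)
  qed
  have "weyl_class k \<inter> weyl_class l \<subseteq> {mat 1}"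
  proof (cases k; cases l)
    fix \<phi> assume "k = Some \<phi>" "l = None"
    then show ?thesis using k None_Some[of \<phi>] by auto
  qed (use assms None_Some Some_Some in \<open>force+\<close>)
  then show ?thesis
    using one_in_weyl_class[OF k] one_in_weyl_class[OF l] by blast
qed

lemma indexed_basis_eigenvector:
  assumes "k \<in> class_indices" "x \<in> indexed_basis k" "A \<in> weyl_class k"
  shows "x \<noteq> 0 \<and> (\<exists>c. A *v x = c *s x)"
proof (cases k)
  case None
  then obtain i \<phi> where x: "x = axis i 1" and A: "A = weyl \<phi> 0"
    using assms by (auto simp: weyl_class_def indexed_basis_def standard_basis_def)
  then have "A *v x = \<phi> i *s x"
    by (simp add: x A vec_eq_iff weyl_vector_mult axis_def)
  then show ?thesis using x by auto
next
  case (Some \<phi>)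
  then obtain f v where f: "f \<in> H_characters" "\<And>b. f (0, b) = \<phi> b"
    and x: "x = restricted_character f" and A: "A = weyl (\<lambda>u. \<phi> (mul u v)) v"
    using assms by (auto simp: weyl_class_def indexed_basis_def fiber_basis_def fiber_def)
  \<comment> \<open>Coordinate by coordinate this is \<open>H_character_add\<close>, with
    \<open>\<phi> (mul u v)\<close> in place of \<open>f (0, mul u v)\<close>.\<close>
  have "A *v x = f (v, 0) *s x"
    using H_character_add[OF f(1), of _ v]
    by (simp add: vec_eq_iff A x weyl_vector_mult restricted_character_nth f(2) mult.commute)
  moreover have "x $ 0 \<noteq> 0"
    using H_character_nonzero[OF f(1)] by (simp add: x restricted_character_nth)
  then have "x \<noteq> 0" by auto
  ultimately show ?thesis by blast
qed

lemma monomial_mubs_semifield_bases: "monomial_mubs (semifield_bases mul)"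
proof -
  define m where "m = CARD('a) + 1"
  have "finite class_indices" by (simp add: finite_dual)
  \<comment> \<open>Classes in \<open>maximal_commuting_basis\<close> are numbered from 1 to
    \<open>m\<close>, so the \<open>option\<close> indices are enumerated.\<close>
  then obtain h where h: "bij_betw h {1..m} class_indices"
    using ex_bij_betw_nat_finite_1[of class_indices] unfolding card_class_indices m_def by blast
  have hI: "h i \<in> class_indices" if "i \<in> {1..m}" for i
    using bij_betwE[OF h] that by blast
  have h_neq: "h i \<noteq> h j" if "i \<in> {1..m}" "j \<in> {1..m}" "i \<noteq> j" for i j
    using bij_betw_imp_inj_on[OF h] that by (meson inj_onD)
  have weyl: "\<exists>\<phi>\<in>dual. \<exists>v. A = weyl \<phi> v" if "i \<in> {1..m}" "A \<in> weyl_class (h i)" for i A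
    using weyl_class_is_weyl[OF hI] that by blast
  have "maximal_commuting_basis m (weyl_class \<circ> h)"
    unfolding maximal_commuting_basis_def o_apply
  proof (intro conjI ballI impI)
    fix A B assume "A \<in> (\<Union>i\<in>{1..m}. weyl_class (h i))" "B \<in> (\<Union>i\<in>{1..m}. weyl_class (h i))" "A \<noteq> B"
    then show "trace_inner A B = 0"
      using weyl trace_inner_weyl by (metis UN_E)
  next
    fix i A assume "i \<in> {1..m}" "A \<in> weyl_class (h i)"
    then show "unitary_matrix A" using weyl unitary_weyl by blast
  next
    fix i j assume "i \<in> {1..m}" "j \<in> {1..m}" "i \<noteq> j"
    then show "weyl_class (h i) \<inter> weyl_class (h j) = {mat 1}"
      by (intro weyl_class_Int hI h_neq)
  qed (use weyl_class_commute[OF hI] in \<open>simp_all add: one_in_weyl_class[OF hI] card_weyl_class[OF hI]\<close>)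
  moreover have "monomial_matrix A" if "i \<in> {1..m}" "A \<in> (weyl_class \<circ> h) i" for i A
    using weyl[of i A] that monomial_weyl by auto
  moreover have "obtained_by_partitioning (semifield_bases mul) m (weyl_class \<circ> h)"
    unfolding obtained_by_partitioning_def
  proof (intro exI[of _ "indexed_basis \<circ> h"] conjI)
    show "bij_betw (indexed_basis \<circ> h) {1..m} (semifield_bases mul)"
      by (rule bij_betw_trans[OF h bij_betw_indexed_basis])
    show "\<forall>i\<in>{1..m}. \<forall>x\<in>(indexed_basis \<circ> h) i. \<forall>A\<in>(weyl_class \<circ> h) i. x \<noteq> 0 \<and> (\<exists>c. A *v x = c *s x)"
      using indexed_basis_eigenvector[OF hI] unfolding o_apply by blast
  qed
  ultimately show ?thesis
    unfolding monomial_mubs_def using mub_set_semifield_bases mub_equivalent_refl by blast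
qed

end

theorem mainTheorem7:
  fixes mul :: "'a::{finite,ab_group_add} \<Rightarrow> 'a \<Rightarrow> 'a" and unit :: 'a and q :: nat
  assumes "finite_commutative_semifield mul unit"
    and "q = CARD('a)"
  shows "card (semifield_bases mul) = q + 1 \<and> monomial_mubs (semifield_bases mul)"
proof -
  interpret finite_commutative_semifield mul unit by fact
  show ?thesis
    \<comment> \<open>The count rests on the injectivity of \<open>indexed_basis\<close>: no two of
      the bases coincide.\<close>
    using bij_betw_same_card[OF bij_betw_indexed_basis] card_class_indices
      monomial_mubs_semifield_bases assms(2) by simp
qed

end
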